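(* Let $p,n\in\mathbb N$ and let $\{\rho_k\}_{k=0}^\infty$ be a sequence of $p\times p$ complex matrices such that $\|\rho_k\|<1$ for all $0\le k<\infty$. Put $\widetilde\rho_k:=\rho_{k+n}$ for $0\le k<\infty$. Let $\mathfrak A_n(z)=\{\mathfrak A_{ij}(z)\}_{i,j=1}^2$ (with $p\times p$ blocks) be the frame determined by $\{\rho_k\}_{k=0}^{n-1}$. Let $\varphi_\infty$ be the Weyl function determined by $\{\rho_k\}_{k=0}^\infty$ and let $\widetilde\varphi_\infty$ be the Weyl function determined by $\{\widetilde\rho_k\}_{k=0}^\infty$. Then, for $z\in\mathbb C_+$, $$\varphi_{\infty}(z)=\mathrm i\,\bigl(\mathfrak A_{11}(z)\,(-\mathrm i\,\widetilde\varphi_\infty(z))+\mathfrak A_{12}(z)\bigr)\bigl(\mathfrak A_{21}(z)\,(-\mathrm i\,\widetilde\varphi_\infty(z))+\mathfrak A_{22}(z)\bigr)^{-1}.$$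
   Context: $\mathbb C_+$ is the open upper half-plane. Put $$J=\begin{bmatrix}0&I_p\\ I_p&0\end{bmatrix},\qquad j=\begin{bmatrix}I_p&0\\0&-I_p\end{bmatrix},\qquad K=\frac1{\sqrt2}\begin{bmatrix}I_p&-I_p\\ I_p&I_p\end{bmatrix}.$$ Given $p\times p$ matrices $\rho_k$ with $\|\rho_k\|<1$ (Verblunsky-type coefficients), set $$C_k=\mathrm{diag}\bigl\{(I_p-\rho_k\rho_k^* )^{-1/2},\,(I_p-\rho_k^*\rho_k)^{-1/2}\bigr\}\begin{bmatrix}I_p&\rho_k\\ \rho_k^*&I_p\end{bmatrix}$$ (then $C_k>0$ and $C_kjC_k=j$). The corresponding discrete Dirac system is $y_{k+1}(z)=(I_{2p}+\mathrm i z\,jC_k)\,y_k(z)$. Its fundamental solution $W_k(z)$ is normalised by $W_0(z)\equiv I_{2p}$, so $W_{k+1}(z)=(I_{2p}+\mathrm i z\,jC_k)W_k(z)$. The frame determined by $\{\rho_k\}_{k=0}^{n-1}$ is $$\mathfrak A_n(z)=\{\mathfrak A_{ij}(z)\}_{i,j=1}^2=\Bigl(1-\frac{\mathrm i}{2}z\Bigr)^{-n}JjK\,W_n(-\overline z/2)^*K^*jJ .$$ A pair $\{R(z),Q(z)\}$ of $p\times p$ matrix functions meromorphic in $\mathbb C_+$ is called nonsingular, with property-$J$, if $R^*R+Q^*Q>0$ and $\begin{bmatrix}R^*&Q^*\end{bmatrix}J\begin{bmatrix}R\\Q\end{bmatrix}\ge0$ in $\mathbb C_+$, excluding possibly some isolated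 points. $\mathcal N(\mathfrak A_n)$ denotes the set of all functions $$\varphi(z)=\mathrm i\,(\mathfrak A_{11}(z)R(z)+\mathfrak A_{12}(z)Q(z))(\mathfrak A_{21}(z)R(z)+\mathfrak A_{22}(z)Q(z))^{-1}\qquad(z\in\mathbb C_+)$$ where $\{R,Q\}$ runs over all such pairs; all these functions are Herglotz functions. For an infinite sequence $\{\rho_k\}_{k=0}^\infty$ with $\|\rho_k\|<1$, the families $\mathcal N(\mathfrak A_n)$ decrease in $n$, and it is known that $\bigcap_{n\ge1}\mathcal N(\mathfrak A_n)$ consists of exactly one function. This function is denoted $\varphi_\infty$ and is called the Weyl function determined by $\{\rho_k\}_{k=0}^\infty$. The function $\widetilde\varphi_\infty$ is obtained by the same construction from $\{\widetilde\rho_k\}_{k=0}^\infty$. *)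

theory Defs
  imports "HOL-Complex_Analysis.Complex_Analysis"
begin

text \<open>
  A \<open>p \<times> p\<close> matrix has type \<open>complex ^ 'p ^ 'p\<close> with \<open>p = CARD('p)\<close>, and a \<open>2p \<times> 2p\<close> matrix is
  indexed by \<open>'p + 'p\<close>, with \<open>Inl\<close> indexing the first \<open>p\<close> coordinates.  Multiplication by a complex
  scalar \<open>c\<close> is written \<open>mat c ** M\<close>.
\<close>

definition mat_adj :: "complex ^ 'n ^ 'm \<Rightarrow> complex ^ 'm ^ 'n" where
  "mat_adj A = (\<chi> i k. cnj (A $ k $ i))"

text \<open>
  The real inner product \<open>v \<bullet> (A *v v)\<close> on \<open>complex ^ 'n\<close> is the real part of \<open>v\<^sup>* A v\<close>, and is
  equal to it when \<open>A\<close> is Hermitian.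
\<close>

definition pos_semidef :: "complex ^ 'n ^ 'n \<Rightarrow> bool" where
  "pos_semidef A \<longleftrightarrow> mat_adj A = A \<and> (\<forall>v. 0 \<le> v \<bullet> (A *v v))"

definition pos_def :: "complex ^ 'n ^ 'n \<Rightarrow> bool" where
  "pos_def A \<longleftrightarrow> mat_adj A = A \<and> (\<forall>v. v \<noteq> 0 \<longrightarrow> 0 < v \<bullet> (A *v v))"

definition psd_sqrt :: "complex ^ 'n ^ 'n \<Rightarrow> complex ^ 'n ^ 'n" where
  "psd_sqrt A = (THE B. pos_semidef B \<and> B ** B = A)"

definition block ::
  "'a ^ 'p ^ 'p \<Rightarrow> 'a ^ 'p ^ 'p \<Rightarrow> 'a ^ 'p ^ 'p \<Rightarrow> 'a ^ 'p ^ 'p \<Rightarrow> 'a ^ ('p + 'p) ^ ('p + 'p)" where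
  "block A B C D = (\<chi> i k. case i of
       Inl a \<Rightarrow> (case k of Inl b \<Rightarrow> A $ a $ b | Inr b \<Rightarrow> B $ a $ b)
     | Inr a \<Rightarrow> (case k of Inl b \<Rightarrow> C $ a $ b | Inr b \<Rightarrow> D $ a $ b))"

definition block11 :: "'a ^ ('p + 'p) ^ ('p + 'p) \<Rightarrow> 'a ^ 'p ^ 'p" where
  "block11 M = (\<chi> a b. M $ Inl a $ Inl b)"

definition block12 :: "'a ^ ('p + 'p) ^ ('p + 'p) \<Rightarrow> 'a ^ 'p ^ 'p" where
  "block12 M = (\<chi> a b. M $ Inl a $ Inr b)"

definition block21 :: "'a ^ ('p + 'p) ^ ('p + 'p) \<Rightarrow> 'a ^ 'p ^ 'p" where
  "block21 M = (\<chi> a b. M $ Inr a $ Inl b)"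

definition block22 :: "'a ^ ('p + 'p) ^ ('p + 'p) \<Rightarrow> 'a ^ 'p ^ 'p" where
  "block22 M = (\<chi> a b. M $ Inr a $ Inr b)"

definition block_col :: "'a ^ 'p ^ 'p \<Rightarrow> 'a ^ 'p ^ 'p \<Rightarrow> 'a ^ 'p ^ ('p + 'p)" where
  "block_col R Q = (\<chi> i b. case i of Inl a \<Rightarrow> R $ a $ b | Inr a \<Rightarrow> Q $ a $ b)"

definition J_mat :: "complex ^ ('p::finite + 'p) ^ ('p + 'p)" where
  "J_mat = block 0 (mat 1) (mat 1) 0"

definition j_mat :: "complex ^ ('p::finite + 'p) ^ ('p + 'p)" where
  "j_mat = block (mat 1) 0 0 (- mat 1)"

definition K_mat :: "complex ^ ('p::finite + 'p) ^ ('p + 'p)" where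
  "K_mat = (1 / sqrt 2) *\<^sub>R block (mat 1) (- mat 1) (mat 1) (mat 1)"

definition C_mat :: "complex ^ 'p ^ 'p \<Rightarrow> complex ^ ('p::finite + 'p) ^ ('p + 'p)" where
  "C_mat \<rho> =
     block (matrix_inv (psd_sqrt (mat 1 - \<rho> ** mat_adj \<rho>))) 0
           0 (matrix_inv (psd_sqrt (mat 1 - mat_adj \<rho> ** \<rho>)))
     ** block (mat 1) \<rho> (mat_adj \<rho>) (mat 1)"

primrec fund_sol ::
  "(nat \<Rightarrow> complex ^ 'p ^ 'p) \<Rightarrow> nat \<Rightarrow> complex \<Rightarrow> complex ^ ('p::finite + 'p) ^ ('p + 'p)" where
  "fund_sol \<rho> 0 z = mat 1"
| "fund_sol \<rho> (Suc k) z =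
     (mat 1 + mat (\<i> * z) ** (j_mat ** C_mat (\<rho> k))) ** fund_sol \<rho> k z"

definition frame ::
  "(nat \<Rightarrow> complex ^ 'p ^ 'p) \<Rightarrow> nat \<Rightarrow> complex \<Rightarrow> complex ^ ('p::finite + 'p) ^ ('p + 'p)" where
  "frame \<rho> n z =
     mat (inverse ((1 - \<i> / 2 * z) ^ n)) **
       (J_mat ** j_mat ** K_mat ** mat_adj (fund_sol \<rho> n (- cnj z / 2))
          ** mat_adj K_mat ** j_mat ** J_mat)"

definition upper_half_plane :: "complex set" where
  "upper_half_plane = {z. Im z > 0}"

text \<open>
  ``Excluding possibly some isolated points'' is rendered by the filter \<open>cosparse\<close>: the exceptional
  set has no accumulation point in the upper half-plane.  The library predicate \<open>meromorphic_on\<close>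
  leaves the values at isolated points arbitrary, so poles of \<open>R\<close> and \<open>Q\<close> are exceptional points.
\<close>

definition nonsingular_J_pair ::
  "(complex \<Rightarrow> complex ^ 'p ^ 'p) \<Rightarrow> (complex \<Rightarrow> complex ^ 'p ^ ('p::finite)) \<Rightarrow> bool" where
  "nonsingular_J_pair R Q \<longleftrightarrow>
     (\<forall>a b. (\<lambda>z. R z $ a $ b) meromorphic_on upper_half_plane) \<and>
     (\<forall>a b. (\<lambda>z. Q z $ a $ b) meromorphic_on upper_half_plane) \<and>
     (\<forall>\<^sub>F z in cosparse upper_half_plane.
        pos_def (mat_adj (R z) ** R z + mat_adj (Q z) ** Q z) \<and>
        pos_semidef (mat_adj (block_col (R z) (Q z)) ** J_mat ** block_col (R z) (Q z)))"

text \<open>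
  The linear fractional expression is an identity of meromorphic functions.  As the functions that
  it represents are Herglotz functions, the representative \<open>\<phi>\<close> is taken to be holomorphic in the
  whole upper half-plane, which fixes its values also at the exceptional points of the expression.
  Values of \<open>\<phi>\<close> outside the upper half-plane are irrelevant.
\<close>

definition N_family ::
  "(complex \<Rightarrow> complex ^ ('p::finite + 'p) ^ ('p + 'p)) \<Rightarrow> (complex \<Rightarrow> complex ^ 'p ^ 'p) set" where
  "N_family \<AA> = {\<phi>.
     (\<forall>a b. (\<lambda>z. \<phi> z $ a $ b) holomorphic_on upper_half_plane) \<and>
     (\<exists>R Q. nonsingular_J_pair R Q \<and>
       (\<forall>\<^sub>F z in cosparse upper_half_plane.
          invertible (block21 (\<AA> z) ** R z + block22 (\<AA> z) ** Q z) \<and>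
          \<phi> z = mat \<i> ** (block11 (\<AA> z) ** R z + block12 (\<AA> z) ** Q z)
                   ** matrix_inv (block21 (\<AA> z) ** R z + block22 (\<AA> z) ** Q z)))}"

text \<open>
  For contractive \<open>\<rho>\<close> the intersection below contains exactly one function on the upper half-plane,
  so that being a member of it amounts to being the Weyl function.  Neither existence nor
  uniqueness is part of the predicate.
\<close>

definition is_weyl_function ::
  "(nat \<Rightarrow> complex ^ 'p ^ 'p) \<Rightarrow> (complex \<Rightarrow> complex ^ 'p ^ ('p::finite)) \<Rightarrow> bool" where
  "is_weyl_function \<rho> \<phi> \<longleftrightarrow> \<phi> \<in> (\<Inter>n\<in>{1..}. N_family (frame \<rho> n))"

end

theory Submission
  imports Defs
begin

text \<open>
  The idea is the nesting of Weyl matrix balls together with a limit point argument that is carried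
  out on single vectors, at one fixed point \<open>z\<close> of the upper half-plane.

  Conjugation with the unitary matrix \<open>T = J j K\<close> turns \<open>J\<close> into \<open>- j\<close>, so a frame becomes, up to a
  scalar factor, the product \<open>P\<^sub>n = M\<^sub>0 M\<^sub>1 \<cdots> M\<^sub>n\<^sub>-\<^sub>1\<close> with \<open>M\<^sub>k = 1 + (\<i> z / 2) C\<^sub>k j\<close>.  Since
  \<open>C\<^sub>k j C\<^sub>k = j\<close>, the product \<open>G\<^sub>n\<close> of the factors \<open>1 - (\<i> z / 2) C\<^sub>k j\<close> in the opposite order satisfies
  \<open>G\<^sub>n P\<^sub>n = (1 + z\<^sup>2 / 4)\<^sup>n\<close>.  Attach to a matrix \<open>\<phi>(z)\<close> the vectors \<open>x = T\<^sup>* [- \<i> \<phi>(z) b; b]\<close>.  If \<open>\<phi>\<close>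
  belongs to the family of the \<open>n\<close>-th frame, then \<open>G\<^sub>n x\<close> is \<open>j\<close>-nonpositive for every \<open>b\<close>
  (\<open>N_family_jform_nonpos\<close>).  This is clear wherever the linear fractional representation is valid, and
  it extends to all \<open>z\<close> by continuity, because \<open>G\<^sub>n\<close> is polynomial in \<open>z\<close>; the inverse of the frame,
  by contrast, does not exist at \<open>z = 2 \<i>\<close> for \<open>n \<ge> 1\<close>.

  Along \<open>g\<^sub>k = G\<^sub>k x\<close> the form \<open>g\<^sup>* j g\<close> obeys
  \<open>g\<^sub>k\<^sub>+\<^sub>1\<^sup>* j g\<^sub>k\<^sub>+\<^sub>1 = c g\<^sub>k\<^sup>* j g\<^sub>k + (Im z) g\<^sub>k\<^sup>* j C\<^sub>k j g\<^sub>k\<close> with \<open>c = 1 + |z|\<^sup>2 / 4\<close>, and \<open>j C\<^sub>k j \<ge> j\<close>.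
  So \<open>g\<^sub>k\<^sup>* j g\<^sub>k / c\<^sup>k\<close> is nondecreasing, and once positive it grows geometrically.  Two vectors whose
  \<open>G\<^sub>k\<close>-images all are \<open>j\<close>-nonpositive therefore coincide as soon as their difference is
  \<open>j\<close>-nonnegative: by the parallelogram law the normalised form of the difference stays bounded
  (\<open>limit_point_uniqueness\<close>).

  Finally, \<open>G\<^sub>n\<^sub>+\<^sub>m\<close> for \<open>\<rho>\<close> factors as \<open>G\<^sub>m\<close> for the shifted sequence times \<open>G\<^sub>n\<close> for \<open>\<rho>\<close>.  Hence both
  \<open>\<phi>\<close> and the linear fractional transform of \<open>\<phi>'\<close> yield vectors with \<open>j\<close>-nonpositive images.  For the
  same \<open>b\<close> the difference of the two vectors comes from \<open>[a; 0]\<close> and is \<open>j\<close>-neutral, so they coincide.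
\<close>

section \<open>Complex matrices acting on vectors\<close>

lemma matrix_eqI_vec:
  "A = B" if "\<And>v. A *v v = B *v (v :: complex ^ 'n)" for A B :: "complex ^ 'n ^ 'm"
  using that by (simp add: matrix_eq)

lemma mat_vec_mult: "mat c *v v = c *s (v :: complex ^ 'n)"
  by (simp add: vec_eq_iff mat_def matrix_vector_mult_def if_distrib if_distribR
      sum.delta cong: if_cong)

lemma mat_vec_smult: "A *v (c *s v) = c *s (A *v v)" for A :: "complex ^ 'n ^ 'm"
  by (simp add: vec_eq_iff matrix_vector_mult_def sum_distrib_left ac_simps)

lemma uminus_mat_vec: "(- A) *v v = - (A *v v)" for A :: "complex ^ 'n ^ 'm"
  by (simp add: vec_eq_iff matrix_vector_mult_def sum_negf)

lemma mat_vec_uminus: "A *v (- v) = - (A *v v)" for A :: "complex ^ 'n ^ 'm"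
  by (simp add: vec_eq_iff matrix_vector_mult_def sum_negf)

lemma scaleR_mat_vec: "(r *\<^sub>R A) *v v = r *\<^sub>R (A *v v)" for A :: "complex ^ 'n ^ 'm"
  by (simp add: vec_eq_iff matrix_vector_mult_def scaleR_sum_right)

lemma mat_vec_scaleR: "A *v (r *\<^sub>R v) = r *\<^sub>R (A *v v)" for A :: "complex ^ 'n ^ 'm"
  by (simp add: vec_eq_iff matrix_vector_mult_def scaleR_sum_right)

lemmas mat_vec_simps = matrix_vector_mul_assoc[symmetric] mat_vec_mult mat_vec_smult
  uminus_mat_vec mat_vec_uminus scaleR_mat_vec matrix_vector_right_distrib
  matrix_vector_mult_diff_distrib matrix_vector_mult_add_rdistrib
  matrix_vector_mult_diff_rdistrib mat_vec_scaleR

lemma smult_scaleR: "c *s (r *\<^sub>R v) = r *\<^sub>R (c *s v)" for v :: "complex ^ 'n"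
  by (simp add: vec_eq_iff)

lemma matrix_diff_ldistrib: "A ** (B - C) = A ** B - A ** C"
  for A :: "complex ^ 'n ^ 'm"
  by (rule matrix_eqI_vec) (simp add: mat_vec_simps)

lemma matrix_diff_rdistrib: "(A - B) ** C = A ** C - B ** C"
  for A :: "complex ^ 'n ^ 'm"
  by (rule matrix_eqI_vec) (simp add: mat_vec_simps)

lemma mat_adj_involutive [simp]: "mat_adj (mat_adj A) = A"
  by (simp add: mat_adj_def vec_eq_iff)

lemma mat_adj_mult: "mat_adj (A ** B) = mat_adj B ** mat_adj A"
  by (simp add: mat_adj_def vec_eq_iff matrix_matrix_mult_def mult.commute)

lemma mat_adj_add: "mat_adj (A + B) = mat_adj A + mat_adj B"
  by (simp add: mat_adj_def vec_eq_iff)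

lemma mat_adj_mat: "mat_adj (mat c) = mat (cnj c)"
  by (auto simp: mat_adj_def vec_eq_iff mat_def)

lemma inner_smult_cnj: "(c *s u) \<bullet> v = u \<bullet> (cnj c *s v)" for u v :: "complex ^ 'n"
  by (simp add: inner_vec_def inner_complex_def algebra_simps)

lemma inner_mat_adj: "(A *v u) \<bullet> v = u \<bullet> (mat_adj A *v v)"
  for A :: "complex ^ 'n ^ 'm"
proof -
  have "(A *v u) \<bullet> v = (\<Sum>i\<in>UNIV. \<Sum>k\<in>UNIV. Re (A $ i $ k * u $ k * cnj (v $ i)))"
    by (simp add: inner_vec_def inner_complex_def matrix_vector_mult_def sum_distrib_right
        flip: sum.distrib)
  also have "\<dots> = (\<Sum>k\<in>UNIV. \<Sum>i\<in>UNIV. Re (A $ i $ k * u $ k * cnj (v $ i)))"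
    by (rule sum.swap)
  also have "\<dots> = u \<bullet> (mat_adj A *v v)"
    by (simp add: inner_vec_def inner_complex_def matrix_vector_mult_def sum_distrib_left
        mat_adj_def algebra_simps flip: sum.distrib)
  finally show ?thesis .
qed

lemma hermitian_inner: "mat_adj A = A \<Longrightarrow> (A *v u) \<bullet> v = u \<bullet> (A *v v)"
  using inner_mat_adj[of A u v] by simp

lemma mat_adj_eqI:
  fixes A :: "complex ^ 'n ^ 'm"
  assumes "\<And>u v. (A *v u) \<bullet> v = u \<bullet> (B *v v)"
  shows "mat_adj A = B"
proof (rule matrix_eqI_vec)
  fix v
  have "u \<bullet> (mat_adj A *v v) = u \<bullet> (B *v v)" for u
    using assms[of u v] by (simp add: inner_mat_adj)
  then show "mat_adj A *v v = B *v v"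
    using vector_eq_rdot by (metis inner_commute)
qed

text \<open>
  By the Cauchy-Schwarz inequality, \<open>|A\<^sup>* v|\<^sup>2 = \<langle>A A\<^sup>* v, v\<rangle> \<le> r |A\<^sup>* v| |v|\<close>.
\<close>

lemma norm_mat_vec_adj_le:
  fixes A :: "complex ^ 'n ^ 'm"
  assumes "\<And>v. norm (A *v v) \<le> r * norm v"
  shows "norm (mat_adj A *v v) \<le> r * norm v"
proof (cases "mat_adj A *v v = 0")
  case True
  have "0 \<le> r * norm (vec 1 :: complex ^ 'n)"
    using assms[of "vec 1"] norm_ge_zero order_trans by blast
  moreover have "0 < norm (vec 1 :: complex ^ 'n)"
    by (simp add: vec_eq_iff)
  ultimately show ?thesis
    using True by (simp add: zero_le_mult_iff)
next
  case False
  let ?w = "mat_adj A *v v"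
  have "norm ?w * norm ?w = (A *v ?w) \<bullet> v"
    by (simp add: inner_mat_adj dot_square_norm power2_eq_square)
  also have "\<dots> \<le> norm (A *v ?w) * norm v"
    by (rule norm_cauchy_schwarz)
  also have "\<dots> \<le> (r * norm ?w) * norm v"
    by (intro mult_right_mono assms) simp
  finally have "norm ?w * norm ?w \<le> norm ?w * (r * norm v)"
    by (simp add: ac_simps)
  then show ?thesis
    using False by simp
qed

lemma matrix_inv_both_sides:
  assumes "invertible (A :: complex ^ 'n ^ 'n)"
  shows "A ** matrix_inv A = mat 1" "matrix_inv A ** A = mat 1"
  using assms someI_ex[of "\<lambda>B. A ** B = mat 1 \<and> B ** A = mat 1"]
  unfolding matrix_inv_def invertible_def by auto

lemma invertible_if_kernel_trivial:
  fixes A :: "complex ^ 'n ^ 'n"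
  assumes "\<And>v. A *v v = 0 \<Longrightarrow> v = 0"
  shows "invertible A"
  using assms by (simp add: invertible_left_inverse matrix_left_invertible_ker)

lemma pos_def_imp_pos_semidef: "pos_def A \<Longrightarrow> pos_semidef A"
  unfolding pos_def_def pos_semidef_def
  by (metis inner_zero_left order_refl order_less_imp_le)

lemma pos_def_invertible: "pos_def A \<Longrightarrow> invertible A"
  by (rule invertible_if_kernel_trivial) (auto simp: pos_def_def)

section \<open>Positive square roots\<close>

text \<open>
  A fixed point of \<open>Y \<mapsto> (X + Y\<^sup>2) / 2\<close> satisfies \<open>(1 - Y)\<^sup>2 = 1 - X\<close>.  The map contracts the ball whose
  radius \<open>s < 1\<close> is the fixed point of the scalar map for \<open>r\<close>, and Hermitian matrices form a closed
  invariant set.  The bound on \<open>X\<close> concerns the operator norm, whereas the norm of the matrix type is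
  the Frobenius norm; hence the iteration is run on bounded real-linear maps, and complex linearity
  has to be carried along as a closed condition.
\<close>

lemma ex_pos_def_sqrt:
  fixes X :: "complex ^ 'n ^ 'n"
  assumes herm: "mat_adj X = X" and r: "r < 1" and bound: "\<And>v. norm (X *v v) \<le> r * norm v"
  shows "\<exists>B. pos_def B \<and> B ** B = mat 1 - X"
proof -
  define X' :: "(complex ^ 'n) \<Rightarrow>\<^sub>L (complex ^ 'n)" where "X' = Blinfun ((*v) X)"
  have X': "blinfun_apply X' v = X *v v" for v
    unfolding X'_def by (simp add: bounded_linear_Blinfun_apply)
  have "0 \<le> r * norm (vec 1 :: complex ^ 'n)"
    using bound[of "vec 1"] norm_ge_zero order_trans by blast
  moreover have "0 < norm (vec 1 :: complex ^ 'n)"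
    by (simp add: vec_eq_iff)
  ultimately have r0: "0 \<le> r"
    by (simp add: zero_le_mult_iff)
  have nX': "norm X' \<le> r"
    by (rule norm_blinfun_bound) (use r0 bound X' in auto)
  define s where "s = 1 - sqrt (1 - r)"
  have s: "0 \<le> s" "s < 1" "(r + s * s) / 2 = s"
    using r0 r by (auto simp: s_def field_simps)
  define S where "S = {Y :: (complex ^ 'n) \<Rightarrow>\<^sub>L (complex ^ 'n). norm Y \<le> s
      \<and> (\<forall>c v. blinfun_apply Y (c *s v) = c *s blinfun_apply Y v)
      \<and> (\<forall>u v. blinfun_apply Y u \<bullet> v = u \<bullet> blinfun_apply Y v)}"
  define f where "f = (\<lambda>Y. (1 / 2) *\<^sub>R (X' + (Y o\<^sub>L Y)))"
  have "closed S"
    unfolding S_def mat_vec_mult[symmetric]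
    by (intro closed_Collect_conj closed_Collect_all closed_Collect_le closed_Collect_eq
        continuous_intros bounded_linear.continuous_on[OF matrix_vector_mul_bounded_linear])
  have "\<exists>!Y\<in>S. f Y = Y"
  proof (rule Banach_fix[OF _ _ s(1,2)])
    show "complete S"
      using \<open>closed S\<close> by (simp add: complete_eq_closed)
    show "S \<noteq> {}"
      using s(1) by (auto simp: S_def intro!: exI[of _ 0])
    show "f ` S \<subseteq> S"
    proof
      fix Z assume "Z \<in> f ` S"
      then obtain Y where Y: "Y \<in> S" "Z = f Y" by auto
      have "norm Z \<le> (r + s * s) / 2"
      proof -
        have "norm (Y o\<^sub>L Y) \<le> norm Y * norm Y"
          by (rule norm_blinfun_compose)
        also have "\<dots> \<le> s * s"
          using Y s(1) by (intro mult_mono) (auto simp: S_def)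
        finally have "norm (X' + (Y o\<^sub>L Y)) \<le> r + s * s"
          using nX' norm_triangle_ineq[of X' "Y o\<^sub>L Y"] by linarith
        then show ?thesis
          by (simp add: Y(2) f_def)
      qed
      then have "norm Z \<le> s" by (simp add: s(3))
      moreover have "blinfun_apply Z (c *s v) = c *s blinfun_apply Z v" for c v
        using Y(1) by (simp add: Y(2) f_def S_def blinfun.bilinear_simps X' mat_vec_smult
            smult_scaleR vector_add_ldistrib)
      moreover have "blinfun_apply Z u \<bullet> v = u \<bullet> blinfun_apply Z v" for u v
        using Y(1) by (simp add: Y(2) f_def S_def blinfun.bilinear_simps X' inner_left_distrib
            inner_right_distrib hermitian_inner[OF herm])
      ultimately show "Z \<in> S" by (simp add: S_def)
    qed
    fix Y Z assume YZ: "Y \<in> S" "Z \<in> S"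
    \<comment> \<open>A splitting of \<open>Y\<^sup>2 - Z\<^sup>2\<close> that is valid although \<open>Y\<close> and \<open>Z\<close> need not commute.\<close>
    have "f Y - f Z = (1 / 2) *\<^sub>R ((Y o\<^sub>L (Y - Z)) + ((Y - Z) o\<^sub>L Z))"
      by (rule blinfun_eqI) (simp add: f_def blinfun.bilinear_simps algebra_simps)
    moreover have "norm ((Y o\<^sub>L (Y - Z)) + ((Y - Z) o\<^sub>L Z)) \<le> s * norm (Y - Z) + norm (Y - Z) * s"
    proof (rule norm_triangle_mono)
      show "norm (Y o\<^sub>L (Y - Z)) \<le> s * norm (Y - Z)"
        using YZ by (intro order_trans[OF norm_blinfun_compose] mult_right_mono) (auto simp: S_def)
      show "norm ((Y - Z) o\<^sub>L Z) \<le> norm (Y - Z) * s"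
        using YZ by (intro order_trans[OF norm_blinfun_compose] mult_left_mono) (auto simp: S_def)
    qed
    ultimately show "dist (f Y) (f Z) \<le> s * dist Y Z"
      by (simp add: dist_norm)
  qed
  then obtain Y where Y: "Y \<in> S" "f Y = Y" by blast
  define B where "B = mat 1 - matrix (blinfun_apply Y)"
  have "Vector_Spaces.linear (*s) (*s) (blinfun_apply Y)"
    using Y(1) by (auto simp: S_def Vector_Spaces.linear_iff blinfun.bilinear_simps vec.vector_space_axioms)
  then have B: "B *v v = v - blinfun_apply Y v" for v
    by (simp add: B_def mat_vec_simps matrix_works)
  have "mat_adj B = B"
    using Y(1) by (intro mat_adj_eqI) (simp add: B S_def inner_diff_left inner_diff_right)
  moreover have "0 < v \<bullet> (B *v v)" if "v \<noteq> 0" for v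
  proof -
    have "norm (blinfun_apply Y v) \<le> s * norm v"
      using Y(1) by (intro order_trans[OF norm_blinfun] mult_right_mono) (auto simp: S_def)
    also have "\<dots> < norm v"
      using that s by simp
    finally have "norm v * norm (blinfun_apply Y v) < norm v * norm v"
      using that by simp
    then have "v \<bullet> blinfun_apply Y v < v \<bullet> v"
      using norm_cauchy_schwarz[of v "blinfun_apply Y v"]
      by (simp add: dot_square_norm power2_eq_square)
    then show ?thesis by (simp add: B inner_diff_right)
  qed
  moreover have "B ** B = mat 1 - X"
  proof (rule matrix_eqI_vec)
    fix v
    have "blinfun_apply (f Y) v = blinfun_apply Y v"
      by (simp add: Y(2))
    then have "(1 / 2) *\<^sub>R (X *v v + blinfun_apply Y (blinfun_apply Y v)) = blinfun_apply Y v"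
      by (simp add: f_def blinfun.bilinear_simps X')
    from arg_cong[OF this, of "scaleR 2"]
    have "X *v v + blinfun_apply Y (blinfun_apply Y v) = 2 *\<^sub>R blinfun_apply Y v"
      by simp
    then show "(B ** B) *v v = (mat 1 - X) *v v"
      by (simp add: mat_vec_simps B blinfun.bilinear_simps scaleR_2 algebra_simps)
  qed
  ultimately show ?thesis
    unfolding pos_def_def by blast
qed

lemma Re_trace_conj:
  fixes A D :: "complex ^ 'n ^ 'n"
  shows "Re (trace (mat_adj D ** A ** D)) = (\<Sum>i\<in>UNIV. column i D \<bullet> (A *v column i D))"
  unfolding trace_def Re_sum
proof (rule sum.cong[OF refl])
  fix i
  have "(mat_adj D ** A ** D) $ i $ i = (\<Sum>k\<in>UNIV. cnj (D $ k $ i) * (A *v column i D) $ k)"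
    unfolding matrix_mul_assoc[symmetric]
    by (simp add: matrix_matrix_mult_def mat_adj_def matrix_vector_mult_def column_def)
  then show "Re ((mat_adj D ** A ** D) $ i $ i) = column i D \<bullet> (A *v column i D)"
    by (simp add: inner_vec_def inner_complex_def column_def)
qed

text \<open>
  The Sylvester equation \<open>A D + D B = 0\<close> with \<open>A > 0\<close> and \<open>B \<ge> 0\<close> has only the trivial solution, by
  traces: \<open>tr (D\<^sup>* A D) = - tr (D B D\<^sup>*)\<close>, where the left side is nonnegative and the right side is
  nonpositive.  Both the uniqueness of square roots and the intertwining relation below reduce to
  this equation.
\<close>

lemma sylvester_eq_0:
  fixes A B D :: "complex ^ 'n ^ 'n"
  assumes A: "pos_def A" and B: "pos_semidef B" and eq: "A ** D = - (D ** B)"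
  shows "D = 0"
proof -
  have "Re (trace (mat_adj D ** A ** D)) = - Re (trace (mat_adj D ** (D ** B)))"
    by (simp add: matrix_mul_assoc[symmetric] eq)
       (simp add: trace_def matrix_matrix_mult_def sum_negf)
  also have "trace (mat_adj D ** (D ** B)) = trace ((D ** B) ** mat_adj D)"
    by (rule trace_mul_sym)
  finally have "Re (trace (mat_adj D ** A ** D)) = - Re (trace (D ** B ** mat_adj D))" .
  moreover have "Re (trace (D ** B ** mat_adj D)) \<ge> 0"
    using Re_trace_conj[of "mat_adj D" B] B by (simp add: pos_semidef_def sum_nonneg)
  ultimately have "(\<Sum>i\<in>UNIV. column i D \<bullet> (A *v column i D)) \<le> 0"
    by (simp add: Re_trace_conj)
  moreover have nn: "0 \<le> column i D \<bullet> (A *v column i D)" for i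
    using pos_def_imp_pos_semidef[OF A] by (simp add: pos_semidef_def)
  ultimately have "(\<Sum>i\<in>UNIV. column i D \<bullet> (A *v column i D)) = 0"
    by (meson antisym sum_nonneg)
  then have "column i D \<bullet> (A *v column i D) = 0" for i
    using nn by (simp add: sum_nonneg_eq_0_iff)
  then have "column i D = 0" for i
    using A unfolding pos_def_def by (metis less_irrefl)
  then show "D = 0"
    by (simp add: column_def vec_eq_iff)
qed

lemma psd_sqrt_eq:
  assumes B: "pos_def B" and sq: "B ** B = A"
  shows "psd_sqrt A = B"
  unfolding psd_sqrt_def
proof (rule the_equality)
  show "pos_semidef B \<and> B ** B = A"
    using assms by (simp add: pos_def_imp_pos_semidef)
next
  fix E assume E: "pos_semidef E \<and> E ** E = A"
  have "B ** (B - E) = - ((B - E) ** E)"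
    using E sq by (simp add: matrix_diff_ldistrib matrix_diff_rdistrib)
  then have "B - E = 0"
    using sylvester_eq_0[OF B] E by blast
  then show "E = B" by simp
qed

text \<open>
  Applied to \<open>1 - \<rho> \<rho>\<^sup>*\<close> and \<open>1 - \<rho>\<^sup>* \<rho>\<close>, this yields the identity
  \<open>(1 - \<rho> \<rho>\<^sup>*)\<^sup>1\<^sup>/\<^sup>2 \<rho> = \<rho> (1 - \<rho>\<^sup>* \<rho>)\<^sup>1\<^sup>/\<^sup>2\<close>, on which all properties of \<open>C\<close> rest.
\<close>

lemma sqrt_intertwine:
  fixes A B R :: "complex ^ 'n ^ 'n"
  assumes A: "pos_def A" and B: "pos_def B" and "A ** A ** R = R ** (B ** B)"
  shows "A ** R = R ** B"
proof -
  have "A ** (A ** R - R ** B) = - ((A ** R - R ** B) ** B)"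
    using assms(3) by (simp add: matrix_diff_ldistrib matrix_diff_rdistrib matrix_mul_assoc)
  then have "A ** R - R ** B = 0"
    using sylvester_eq_0[OF A pos_def_imp_pos_semidef[OF B]] by blast
  then show ?thesis by simp
qed

section \<open>Block vectors and the matrices \<open>C\<close>\<close>

definition vec_join :: "'a ^ 'p \<Rightarrow> 'a ^ 'p \<Rightarrow> 'a ^ ('p + 'p)" where
  "vec_join a b = (\<chi> i. case i of Inl k \<Rightarrow> a $ k | Inr k \<Rightarrow> b $ k)"

lemma vec_join_cases: obtains a b where "x = vec_join a b"
proof
  show "x = vec_join (\<chi> i. x $ Inl i) (\<chi> i. x $ Inr i)"
    by (simp add: vec_join_def vec_eq_iff split: sum.split)
qed

lemma sum_UNIV_Plus: "(\<Sum>i\<in>UNIV. f i) = (\<Sum>i\<in>UNIV. f (Inl i)) + (\<Sum>i\<in>UNIV. f (Inr i))"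
  for f :: "('p::finite) + 'p \<Rightarrow> 'b::comm_monoid_add"
  by (simp add: UNIV_Plus_UNIV[symmetric] sum.Plus del: UNIV_Plus_UNIV)

lemma block_vec_join: "block A B C D *v vec_join a b = vec_join (A *v a + B *v b) (C *v a + D *v b)"
  by (simp add: vec_eq_iff block_def vec_join_def matrix_vector_mult_def sum_UNIV_Plus split: sum.split)

lemma block_col_vec: "block_col R Q *v b = vec_join (R *v b) (Q *v b)"
  by (simp add: vec_eq_iff block_col_def vec_join_def matrix_vector_mult_def split: sum.split)

lemma block_collapse: "block (block11 M) (block12 M) (block21 M) (block22 M) = M"
  by (simp add: vec_eq_iff block_def block11_def block12_def block21_def block22_def split: sum.split)

lemma inner_vec_join: "vec_join a b \<bullet> vec_join c d = a \<bullet> c + b \<bullet> d"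
  by (simp add: inner_vec_def vec_join_def sum_UNIV_Plus)

lemma vec_join_eq_iff: "vec_join a b = vec_join c d \<longleftrightarrow> a = c \<and> b = d"
  by (auto simp: vec_join_def vec_eq_iff split: sum.split_asm sum.split)

lemma vec_join_diff: "vec_join a b - vec_join c d = vec_join (a - c) (b - d)"
  by (simp add: vec_eq_iff vec_join_def split: sum.split)

lemma vec_join_0: "vec_join 0 0 = 0"
  by (simp add: vec_eq_iff vec_join_def split: sum.split)

lemma J_vec: "J_mat *v vec_join a b = vec_join b a"
  by (simp add: J_mat_def block_vec_join)

lemma mat_adj_J [simp]: "mat_adj J_mat = J_mat"
  by (rule mat_adj_eqI)
     (metis (no_types) add.commute inner_vec_join J_vec vec_join_cases)

lemma j_vec: "j_mat *v vec_join a b = vec_join a (- b)"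
  by (simp add: j_mat_def block_vec_join uminus_mat_vec)

lemma mat_adj_j [simp]: "mat_adj j_mat = j_mat"
  by (rule mat_adj_eqI)
     (metis (no_types) inner_minus_left inner_minus_right inner_vec_join j_vec vec_join_cases)

lemma j_j_vec: "j_mat *v (j_mat *v x) = x"
  by (cases x rule: vec_join_cases) (simp add: j_vec)

lemma hermitian_inner_j: "(j_mat *v x) \<bullet> y = x \<bullet> (j_mat *v y)"
  by (rule hermitian_inner) simp

text \<open>
  With \<open>S = (1 - \<rho> \<rho>\<^sup>*)\<^sup>1\<^sup>/\<^sup>2\<close>, \<open>U = (1 - \<rho>\<^sup>* \<rho>)\<^sup>1\<^sup>/\<^sup>2\<close> and \<open>S \<rho> = \<rho> U\<close>, the diagonal factor of \<open>C\<close> passes to the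
  other side of the block matrix, which makes \<open>C\<close> Hermitian and \<open>C j C = j\<close> a block computation.
  Positivity is completion of the square: for \<open>x = [S u; U v]\<close> one has
  \<open>x\<^sup>* C x = (u + \<rho> v)\<^sup>* S (u + \<rho> v) + (U v)\<^sup>* U (U v)\<close>.
\<close>

lemma C_mat_hermitian_j_unitary_pos_def:
  fixes \<rho> :: "complex ^ 'p ^ ('p::finite)"
  assumes contr: "onorm ((*v) \<rho>) < 1"
  shows "mat_adj (C_mat \<rho>) = C_mat \<rho>"
    and "C_mat \<rho> ** j_mat ** C_mat \<rho> = j_mat"
    and "pos_def (C_mat \<rho>)"
proof -
  define r where "r = onorm ((*v) \<rho>)"
  have r: "r < 1" using contr by (simp add: r_def)
  have r0: "0 \<le> r" by (simp add: r_def onorm_pos_le)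
  have b1: "norm (\<rho> *v v) \<le> r * norm v" for v
    unfolding r_def by (rule onorm) simp
  have b2: "norm (mat_adj \<rho> *v v) \<le> r * norm v" for v
    by (rule norm_mat_vec_adj_le[OF b1])
  have le: "r * (r * norm v) \<le> r * norm v" for v :: "complex ^ 'p"
    using r r0 by (intro mult_left_mono) (auto intro: mult_left_le_one_le)
  have "norm ((\<rho> ** mat_adj \<rho>) *v v) \<le> r * norm v" for v
    using b1[of "mat_adj \<rho> *v v"] mult_left_mono[OF b2[of v] r0] le[of v]
    by (simp add: mat_vec_simps)
  then obtain S where S: "pos_def S" "S ** S = mat 1 - \<rho> ** mat_adj \<rho>"
    using ex_pos_def_sqrt[OF _ r, of "\<rho> ** mat_adj \<rho>"] by (auto simp: mat_adj_mult)
  have "norm ((mat_adj \<rho> ** \<rho>) *v v) \<le> r * norm v" for v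
    using b2[of "\<rho> *v v"] mult_left_mono[OF b1[of v] r0] le[of v]
    by (simp add: mat_vec_simps)
  then obtain U where U: "pos_def U" "U ** U = mat 1 - mat_adj \<rho> ** \<rho>"
    using ex_pos_def_sqrt[OF _ r, of "mat_adj \<rho> ** \<rho>"] by (auto simp: mat_adj_mult)
  have "S ** S ** \<rho> = \<rho> ** (U ** U)"
    by (simp add: S(2) U(2) matrix_diff_ldistrib matrix_diff_rdistrib matrix_mul_assoc)
  then have SU: "S ** \<rho> = \<rho> ** U"
    by (rule sqrt_intertwine[OF S(1) U(1)])
  have hS: "mat_adj S = S" and hU: "mat_adj U = U"
    using S U by (auto simp: pos_def_def)
  define \<alpha> \<beta> where "\<alpha> = matrix_inv S" and "\<beta> = matrix_inv U"
  have a: "S ** \<alpha> = mat 1" "\<alpha> ** S = mat 1" and b: "U ** \<beta> = mat 1" "\<beta> ** U = mat 1"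
    unfolding \<alpha>_def \<beta>_def using matrix_inv_both_sides pos_def_invertible S U by blast+
  have av: "S *v (\<alpha> *v x) = x" "\<alpha> *v (S *v x) = x" "U *v (\<beta> *v x) = x" "\<beta> *v (U *v x) = x" for x
    by (simp_all add: matrix_vector_mul_assoc a b)
  have SUv: "S *v (\<rho> *v x) = \<rho> *v (U *v x)" for x
    by (simp add: matrix_vector_mul_assoc SU)
  have ab: "\<alpha> *v (\<rho> *v x) = \<rho> *v (\<beta> *v x)" for x
    by (metis SUv av)
  have USv: "U *v (mat_adj \<rho> *v x) = mat_adj \<rho> *v (S *v x)" for x
    using arg_cong[OF SU, of mat_adj] by (simp add: mat_adj_mult hS hU matrix_vector_mul_assoc)
  have ba: "\<beta> *v (mat_adj \<rho> *v x) = mat_adj \<rho> *v (\<alpha> *v x)" for x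
    by (metis USv av)
  have SSv: "S *v (S *v x) = x - \<rho> *v (mat_adj \<rho> *v x)" for x
    using arg_cong[OF S(2), of "\<lambda>M. M *v x"] by (simp add: mat_vec_simps)
  have UUv: "U *v (U *v x) = x - mat_adj \<rho> *v (\<rho> *v x)" for x
    using arg_cong[OF U(2), of "\<lambda>M. M *v x"] by (simp add: mat_vec_simps)
  have hSv: "(S *v x) \<bullet> y = x \<bullet> (S *v y)" and hUv: "(U *v x) \<bullet> y = x \<bullet> (U *v y)" for x y
    using hermitian_inner hS hU by blast+
  have h\<alpha>: "(\<alpha> *v x) \<bullet> y = x \<bullet> (\<alpha> *v y)" and h\<beta>: "(\<beta> *v x) \<bullet> y = x \<bullet> (\<beta> *v y)" for x y
    by (metis av hSv, metis av hUv)
  have h\<rho>: "(\<rho> *v x) \<bullet> y = x \<bullet> (mat_adj \<rho> *v y)" "(mat_adj \<rho> *v x) \<bullet> y = x \<bullet> (\<rho> *v y)" for x y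
    by (simp_all add: inner_mat_adj)
  have "psd_sqrt (mat 1 - \<rho> ** mat_adj \<rho>) = S" "psd_sqrt (mat 1 - mat_adj \<rho> ** \<rho>) = U"
    using psd_sqrt_eq S U by blast+
  then have C: "C_mat \<rho> *v vec_join x y
      = vec_join (\<alpha> *v (x + \<rho> *v y)) (\<beta> *v (mat_adj \<rho> *v x + y))" for x y
    by (simp add: C_mat_def \<alpha>_def \<beta>_def mat_vec_simps block_vec_join)
  show herm: "mat_adj (C_mat \<rho>) = C_mat \<rho>"
  proof (rule mat_adj_eqI)
    fix x y :: "complex ^ ('p + 'p)"
    obtain x1 x2 y1 y2 where "x = vec_join x1 x2" "y = vec_join y1 y2"
      by (metis vec_join_cases)
    then show "(C_mat \<rho> *v x) \<bullet> y = x \<bullet> (C_mat \<rho> *v y)"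
      by (simp add: C inner_vec_join mat_vec_simps inner_left_distrib inner_right_distrib ab ba h\<alpha> h\<beta> h\<rho>)
  qed
  show "C_mat \<rho> ** j_mat ** C_mat \<rho> = j_mat"
  proof (rule matrix_eqI_vec)
    fix x :: "complex ^ ('p + 'p)"
    obtain x1 x2 where x: "x = vec_join x1 x2"
      by (metis vec_join_cases)
    have 1: "\<alpha> *v (\<alpha> *v v) - \<rho> *v (\<beta> *v (\<beta> *v (mat_adj \<rho> *v v))) = v" for v
    proof -
      have "\<alpha> *v (\<alpha> *v v) - \<rho> *v (\<beta> *v (\<beta> *v (mat_adj \<rho> *v v)))
          = \<alpha> *v (\<alpha> *v (v - \<rho> *v (mat_adj \<rho> *v v)))"
        by (simp add: mat_vec_simps ab)
      also have "\<dots> = v" by (simp add: SSv[symmetric] av)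
      finally show ?thesis .
    qed
    have 2: "\<beta> *v (\<beta> *v v) - mat_adj \<rho> *v (\<alpha> *v (\<alpha> *v (\<rho> *v v))) = v" for v
    proof -
      have "\<beta> *v (\<beta> *v v) - mat_adj \<rho> *v (\<alpha> *v (\<alpha> *v (\<rho> *v v)))
          = \<beta> *v (\<beta> *v (v - mat_adj \<rho> *v (\<rho> *v v)))"
        by (simp add: mat_vec_simps ba)
      also have "\<dots> = v" by (simp add: UUv[symmetric] av)
      finally show ?thesis .
    qed
    show "(C_mat \<rho> ** j_mat ** C_mat \<rho>) *v x = j_mat *v x"
      using 1[of x1] 2[of x2]
      by (simp add: x matrix_vector_mul_assoc[symmetric] C j_vec vec_join_eq_iff)
         (simp add: mat_vec_simps ab ba algebra_simps)
  qed
  have "0 < x \<bullet> (C_mat \<rho> *v x)" if "x \<noteq> 0" for x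
  proof -
    obtain x1 x2 where x: "x = vec_join x1 x2"
      by (metis vec_join_cases)
    define u v where "u = \<alpha> *v x1" and "v = \<beta> *v x2"
    have x12: "x1 = S *v u" "x2 = U *v v"
      by (simp_all add: u_def v_def av)
    have "x \<bullet> (C_mat \<rho> *v x)
        = (u + \<rho> *v v) \<bullet> (S *v (u + \<rho> *v v)) + (U *v v) \<bullet> (U *v (U *v v))"
    proof -
      have "x \<bullet> (C_mat \<rho> *v x) = (S *v u) \<bullet> (u + \<rho> *v v) + (U *v v) \<bullet> (mat_adj \<rho> *v u + v)"
        by (simp add: x x12 C inner_vec_join mat_vec_simps av ab ba)
      moreover have "(U *v v) \<bullet> (U *v (U *v v)) = (U *v v) \<bullet> v - (\<rho> *v v) \<bullet> (S *v (\<rho> *v v))"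
        by (simp add: UUv inner_diff_right h\<rho>[symmetric] SUv) (metis h\<rho> hUv SUv inner_commute)
      moreover have "(U *v v) \<bullet> (mat_adj \<rho> *v u) = (S *v u) \<bullet> (\<rho> *v v)"
        by (metis h\<rho>(1) hSv SUv inner_commute)
      moreover have "(\<rho> *v v) \<bullet> (S *v u) = (S *v u) \<bullet> (\<rho> *v v)" "u \<bullet> (S *v u) = (S *v u) \<bullet> u"
          "u \<bullet> (S *v (\<rho> *v v)) = (S *v u) \<bullet> (\<rho> *v v)"
        by (simp_all add: inner_commute hSv)
      ultimately show ?thesis
        by (simp add: inner_left_distrib inner_right_distrib mat_vec_simps)
    qed
    moreover have "0 \<le> w \<bullet> (S *v w)" "0 \<le> w \<bullet> (U *v w)"
        "w \<noteq> 0 \<Longrightarrow> 0 < w \<bullet> (S *v w)" "w \<noteq> 0 \<Longrightarrow> 0 < w \<bullet> (U *v w)" for w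
      using S(1) U(1) pos_def_imp_pos_semidef[of S] pos_def_imp_pos_semidef[of U]
      by (auto simp: pos_def_def pos_semidef_def)
    moreover have "U *v v \<noteq> 0 \<or> u + \<rho> *v v \<noteq> 0"
    proof (rule ccontr)
      assume "\<not> ?thesis"
      then have "U *v v = 0" "u + \<rho> *v v = 0" by auto
      then have "v = 0" "u = 0" using av(4)[of v] by auto
      then show False using that by (simp add: x x12 vec_join_0)
    qed
    ultimately show ?thesis
      by (metis add_nonneg_pos add_pos_nonneg)
  qed
  then show "pos_def (C_mat \<rho>)"
    using herm by (simp add: pos_def_def)
qed

section \<open>The indefinite form along the discrete Dirac system\<close>

text \<open>
  The real inner product only sees real parts.  For Hermitian \<open>A\<close> the number \<open>u\<^sup>* A u\<close> is real, so
  the imaginary part of the scalar does not contribute.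
\<close>

lemma hermitian_inner_smult:
  assumes "mat_adj A = A"
  shows "u \<bullet> (a *s (A *v u)) = Re a * (u \<bullet> (A *v u))"
proof -
  have split: "a *s x = Re a *\<^sub>R x + Im a *\<^sub>R (\<i> *s x)" for x :: "complex ^ 'a"
    by (simp add: vec_eq_iff complex_eq_iff)
  have "u \<bullet> (\<i> *s (A *v u)) = - (u \<bullet> (\<i> *s (A *v u)))"
  proof -
    have "u \<bullet> (\<i> *s (A *v u)) = (A *v u) \<bullet> (\<i> *s u)"
      by (metis assms hermitian_inner mat_vec_smult)
    also have "\<dots> = ((- \<i>) *s (A *v u)) \<bullet> u"
      by (simp add: inner_smult_cnj)
    also have "\<dots> = - (u \<bullet> (\<i> *s (A *v u)))"
      by (simp add: inner_commute)
    finally show ?thesis .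
  qed
  then show ?thesis
    by (subst split) (simp add: inner_right_distrib)
qed

definition jform :: "complex ^ ('p::finite + 'p) \<Rightarrow> real" where
  "jform x = x \<bullet> (j_mat *v x)"

lemma jform_smult: "jform (c *s x) = (cmod c)\<^sup>2 * jform x"
proof -
  have "jform (c *s x) = x \<bullet> ((cnj c * c) *s (j_mat *v x))"
    by (simp add: jform_def inner_smult_cnj mat_vec_smult)
  also have "cnj c * c = of_real ((cmod c)\<^sup>2)"
    by (metis complex_norm_square mult.commute)
  finally show ?thesis
    by (simp add: hermitian_inner_smult jform_def)
qed

lemma jform_parallelogram: "jform (x + y) + jform (x - y) = 2 * jform x + 2 * jform y"
  by (simp add: jform_def mat_vec_simps inner_simps)

lemma continuous_on_mat_vec:
  fixes v :: "'b::topological_space \<Rightarrow> complex ^ 'n" and A :: "'b \<Rightarrow> complex ^ 'n ^ 'm"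
  assumes "continuous_on S A" "continuous_on S v"
  shows "continuous_on S (\<lambda>z. A z *v v z)"
  unfolding matrix_vector_mult_def by (intro continuous_intros assms)

lemma continuous_on_smult:
  fixes v :: "'b::topological_space \<Rightarrow> complex ^ 'n"
  assumes "continuous_on S c" "continuous_on S v"
  shows "continuous_on S (\<lambda>z. c z *s v z)"
  unfolding vector_scalar_mult_def by (intro continuous_intros assms)

lemma continuous_on_vec_join:
  fixes v w :: "'b::topological_space \<Rightarrow> complex ^ 'n"
  assumes "continuous_on S v" "continuous_on S w"
  shows "continuous_on S (\<lambda>z. vec_join (v z) (w z))"
  unfolding vec_join_def
proof (intro continuous_on_vec_lambda)
  show "continuous_on S (\<lambda>z. case i of Inl k \<Rightarrow> v z $ k | Inr k \<Rightarrow> w z $ k)" for i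
    by (cases i) (auto intro!: continuous_intros assms)
qed

lemma continuous_on_matrixI:
  fixes A :: "'b::topological_space \<Rightarrow> complex ^ 'n ^ 'm"
  assumes "\<And>a b. continuous_on S (\<lambda>z. A z $ a $ b)"
  shows "continuous_on S A"
proof -
  have "continuous_on S (\<lambda>z. \<chi> a b. A z $ a $ b)"
    by (intro continuous_on_vec_lambda assms)
  then show ?thesis by simp
qed

context
  fixes C :: "complex ^ ('p::finite + 'p) ^ ('p + 'p)"
  assumes herm: "mat_adj C = C" and CjC: "C ** j_mat ** C = j_mat" and pos: "pos_def C"
begin

lemma CjC_vec: "C *v (j_mat *v (C *v x)) = j_mat *v x"
  using arg_cong[OF CjC, of "\<lambda>M. M *v x"] by (simp add: mat_vec_simps)

text \<open>
  One step of the system, in both directions: \<open>a = \<i> z / 2\<close> gives the factor of the frame and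
  \<open>a = - \<i> z / 2\<close> that of its inverse, up to a scalar.  The mixed terms combine to \<open>2 Re a\<close> times
  the form of \<open>j C j\<close>, and \<open>C j C = j\<close> turns the quadratic term into \<open>|a|\<^sup>2\<close> times the form of \<open>j\<close>.
\<close>

lemma jform_step:
  "jform (x + a *s (C *v (j_mat *v x))) =
     (1 + (cmod a)\<^sup>2) * jform x + 2 * Re a * ((j_mat *v x) \<bullet> (C *v (j_mat *v x)))"
proof -
  define u w where "u = j_mat *v x" and "w = C *v u"
  have 1: "x \<bullet> (j_mat *v (a *s w)) = Re a * (u \<bullet> w)"
    unfolding hermitian_inner_j[symmetric] u_def[symmetric] w_def
    by (rule hermitian_inner_smult[OF herm])
  have 2: "(a *s w) \<bullet> (j_mat *v x) = Re a * (u \<bullet> w)"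
    using 1 by (metis hermitian_inner_j inner_commute)
  have "w \<bullet> (j_mat *v w) = jform x"
    unfolding w_def hermitian_inner[OF herm] CjC_vec
    by (simp add: u_def j_j_vec jform_def inner_commute)
  then have 3: "(a *s w) \<bullet> (j_mat *v (a *s w)) = (cmod a)\<^sup>2 * jform x"
    using jform_smult[of a w] by (simp add: jform_def)
  have "jform (x + a *s w) = jform x + x \<bullet> (j_mat *v (a *s w)) + (a *s w) \<bullet> (j_mat *v x)
      + (a *s w) \<bullet> (j_mat *v (a *s w))"
    by (simp add: jform_def matrix_vector_right_distrib inner_left_distrib inner_right_distrib)
  then show ?thesis
    unfolding 1 2 3 by (simp add: algebra_simps u_def w_def)
qed

text \<open>
  From \<open>C\<^sup>-\<^sup>1 = j C j\<close> follows \<open>(C - j) j C j (C - j) = 2 (C - j)\<close>, and the left side is positive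
  semidefinite.
\<close>

lemma C_ge_j: "jform x \<le> x \<bullet> (C *v x)"
proof -
  define y where "y = C *v x - j_mat *v x"
  \<comment> \<open>The form of \<open>j C j\<close> at \<open>y = (C - j) x\<close>.\<close>
  have "0 \<le> (j_mat *v y) \<bullet> (C *v (j_mat *v y))"
    using pos_def_imp_pos_semidef[OF pos] by (simp add: pos_semidef_def)
  also have "(j_mat *v y) \<bullet> (C *v (j_mat *v y)) = y \<bullet> (j_mat *v (C *v (j_mat *v y)))"
    by (rule hermitian_inner_j)
  also have "j_mat *v (C *v (j_mat *v y)) = x - j_mat *v (C *v x)"
    by (simp add: y_def mat_vec_simps CjC_vec j_j_vec)
  also have "y \<bullet> (x - j_mat *v (C *v x)) = 2 * (x \<bullet> (C *v x) - jform x)"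
    by (simp add: y_def inner_diff_left inner_diff_right hermitian_inner[OF herm]
        hermitian_inner_j CjC_vec j_j_vec jform_def)
  finally show ?thesis by simp
qed

lemma jCj_ge_j: "jform x \<le> (j_mat *v x) \<bullet> (C *v (j_mat *v x))"
  using C_ge_j[of "j_mat *v x"] by (simp add: jform_def j_j_vec inner_commute)

lemma jCj_pos: "x \<noteq> 0 \<Longrightarrow> 0 < (j_mat *v x) \<bullet> (C *v (j_mat *v x))"
  using pos unfolding pos_def_def by (metis j_j_vec matrix_vector_mult_0_right)

lemma jCj_nonneg: "0 \<le> (j_mat *v x) \<bullet> (C *v (j_mat *v x))"
  using pos_def_imp_pos_semidef[OF pos] by (simp add: pos_semidef_def)

end

section \<open>Frames in diagonal coordinates\<close>

definition T_mat :: "complex ^ ('p::finite + 'p) ^ ('p + 'p)" where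
  "T_mat = J_mat ** j_mat ** K_mat"

lemma mat_adj_K: "mat_adj K_mat = (1 / sqrt 2) *\<^sub>R block (mat 1) (mat 1) (- mat 1) (mat 1)"
  by (simp add: K_mat_def mat_adj_def block_def vec_eq_iff mat_def split: sum.split)

lemma mat_adj_T: "mat_adj T_mat = mat_adj K_mat ** j_mat ** J_mat"
  by (simp add: T_mat_def mat_adj_mult matrix_mul_assoc)

lemma T_vec: "T_mat *v vec_join a b = (1 / sqrt 2) *\<^sub>R vec_join (- a - b) (a - b)"
  by (simp add: T_mat_def K_mat_def mat_vec_simps block_vec_join j_vec J_vec)

lemma T_adj_vec: "mat_adj T_mat *v vec_join a b = (1 / sqrt 2) *\<^sub>R vec_join (b - a) (- a - b)"
  by (simp add: mat_adj_T mat_adj_K mat_vec_simps block_vec_join j_vec J_vec algebra_simps)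

lemma half_vec_join_double:
  "(1 / sqrt 2) *\<^sub>R ((1 / sqrt 2) *\<^sub>R vec_join (a + a) (b + b)) = (vec_join a b :: complex ^ ('p::finite + 'p))"
proof -
  have "vec_join (a + a) (b + b) = 2 *\<^sub>R vec_join a b"
    by (simp add: vec_join_def vec_eq_iff scaleR_2 split: sum.split)
  then show ?thesis by simp
qed

lemma T_adj_T: "T_mat *v (mat_adj T_mat *v x) = x"
proof (cases x rule: vec_join_cases)
  case (1 a b)
  have "- (b - a) - (- a - b) = a + a" "(b - a) - (- a - b) = b + b" by simp_all
  then show ?thesis
    by (simp only: 1 T_adj_vec T_vec mat_vec_scaleR half_vec_join_double)
qed

lemma T_unitary: "mat_adj T_mat *v (T_mat *v x) = x"
proof (cases x rule: vec_join_cases)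
  case (1 a b)
  have "(a - b) - (- a - b) = a + a" "- (- a - b) - (a - b) = b + b" by simp_all
  then show ?thesis
    by (simp only: 1 T_adj_vec T_vec mat_vec_scaleR half_vec_join_double)
qed

lemma T_j_T_adj: "T_mat *v (j_mat *v (mat_adj T_mat *v x)) = - (J_mat *v x)"
proof (cases x rule: vec_join_cases)
  case (1 a b)
  have "- (b - a) - - (- a - b) = - b + - b" "(b - a) - - (- a - b) = - a + - a" by simp_all
  then have "T_mat *v (j_mat *v (mat_adj T_mat *v x)) = vec_join (- b) (- a)"
    by (simp only: 1 T_adj_vec T_vec j_vec mat_vec_scaleR half_vec_join_double)
  then show ?thesis
    by (simp add: 1 J_vec) (simp add: vec_join_def vec_eq_iff split: sum.split)
qed

text \<open>
  The coordinates in which property-\<open>J\<close> becomes \<open>j\<close>-nonpositivity.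
\<close>

lemma jform_T_adj: "jform (mat_adj T_mat *v x) = - (x \<bullet> (J_mat *v x))"
  by (simp add: jform_def inner_mat_adj T_j_T_adj)

text \<open>
  The product \<open>M\<^sub>0 \<cdots> M\<^sub>n\<^sub>-\<^sub>1\<close> of the factors \<open>M\<^sub>k = 1 + (\<i> z / 2) C\<^sub>k j\<close> (see \<open>trans_mat_Suc_vec\<close>), which
  are the adjoints of the factors of the fundamental solution at \<open>- cnj z / 2\<close>.
\<close>

definition trans_mat :: "(nat \<Rightarrow> complex ^ 'p ^ 'p) \<Rightarrow> nat \<Rightarrow> complex \<Rightarrow> complex ^ ('p::finite + 'p) ^ ('p + 'p)"
  where "trans_mat \<rho> n z = mat_adj (fund_sol \<rho> n (- cnj z / 2))"

lemma frame_vec: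
  "mat_adj T_mat *v (frame \<rho> n z *v x) =
     inverse ((1 - \<i> / 2 * z) ^ n) *s (trans_mat \<rho> n z *v (mat_adj T_mat *v x))"
proof -
  have "frame \<rho> n z = mat (inverse ((1 - \<i> / 2 * z) ^ n)) ** (T_mat ** trans_mat \<rho> n z ** mat_adj T_mat)"
    unfolding frame_def mat_adj_T by (simp only: T_mat_def trans_mat_def matrix_mul_assoc)
  then show ?thesis
    by (simp add: mat_vec_simps T_unitary)
qed

text \<open>
  The inverse of \<^const>\<open>trans_mat\<close> cleared of its denominator \<open>(1 + z\<^sup>2 / 4)\<^sup>n\<close>
  (see \<open>back_sol_trans_mat\<close>), which makes it continuous also at the zero \<open>z = 2 \<i>\<close> of the denominator.
\<close>

primrec back_sol ::
  "(nat \<Rightarrow> complex ^ 'p ^ 'p) \<Rightarrow> nat \<Rightarrow> complex \<Rightarrow> complex ^ ('p::finite + 'p) ^ ('p + 'p)" where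
  "back_sol \<rho> 0 z = mat 1"
| "back_sol \<rho> (Suc k) z =
     (mat 1 + mat (- (\<i> * z / 2)) ** (C_mat (\<rho> k) ** j_mat)) ** back_sol \<rho> k z"

declare back_sol.simps(2) [simp del]

lemma back_sol_add: "back_sol \<rho> (n + m) z = back_sol (\<lambda>k. \<rho> (k + n)) m z ** back_sol \<rho> n z"
  by (induction m) (simp_all add: back_sol.simps(2) matrix_mul_assoc add.commute)

lemma continuous_on_back_sol:
  assumes "continuous_on S v"
  shows "continuous_on S (\<lambda>z. back_sol \<rho> m z *v v z)"
proof (induction m)
  case 0
  then show ?case using assms by simp
next
  case (Suc m)
  have "continuous_on S (\<lambda>z. - (\<i> * z / 2))"
    by (intro continuous_intros) auto
  note continuous_on_add[OF Suc continuous_on_smult[OF this continuous_on_mat_vec[OF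
        continuous_on_const continuous_on_mat_vec[OF continuous_on_const Suc]]]]
  then show ?case
    by (simp add: back_sol.simps(2) mat_vec_simps)
qed

context
  fixes \<rho> :: "nat \<Rightarrow> complex ^ 'p ^ ('p::finite)"
  assumes contractive: "\<And>k. onorm ((*v) (\<rho> k)) < 1"
begin

lemmas C_herm = C_mat_hermitian_j_unitary_pos_def(1)[OF contractive] and C_jC = C_mat_hermitian_j_unitary_pos_def(2)[OF contractive]
  and C_pos = C_mat_hermitian_j_unitary_pos_def(3)[OF contractive]

lemma trans_mat_Suc_vec:
  "trans_mat \<rho> (Suc k) z *v x =
     trans_mat \<rho> k z *v (x + (\<i> * z / 2) *s (C_mat (\<rho> k) *v (j_mat *v x)))"
  by (simp add: trans_mat_def mat_adj_mult mat_adj_add mat_adj_mat mat_vec_simps C_herm)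

lemma back_sol_trans_mat:
  "back_sol \<rho> m z *v (trans_mat \<rho> m z *v x) = (1 + z\<^sup>2 / 4) ^ m *s x"
proof (induction m arbitrary: x)
  case 0
  then show ?case by (simp add: trans_mat_def mat_adj_mat)
next
  case (Suc m)
  let ?a = "\<i> * z / 2" and ?w = "C_mat (\<rho> m) *v (j_mat *v x)"
  let ?y = "x + ?a *s ?w"
  have "C_mat (\<rho> m) *v (j_mat *v ?w) = x"
    by (simp add: CjC_vec[OF C_herm C_jC C_pos] j_j_vec)
  then have "?y + (- ?a) *s (C_mat (\<rho> m) *v (j_mat *v ?y)) = x - (?a * ?a) *s x"
    by (simp add: mat_vec_simps vector_add_ldistrib)
  also have "\<dots> = (1 + z\<^sup>2 / 4) *s x"
    by (simp add: vec_eq_iff power2_eq_square algebra_simps)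
  finally have eq: "?y + (- ?a) *s (C_mat (\<rho> m) *v (j_mat *v ?y)) = (1 + z\<^sup>2 / 4) *s x" .
  have "back_sol \<rho> (Suc m) z *v (trans_mat \<rho> (Suc m) z *v x)
      = (1 + z\<^sup>2 / 4) ^ m *s (?y + (- ?a) *s (C_mat (\<rho> m) *v (j_mat *v ?y)))"
    unfolding trans_mat_Suc_vec back_sol.simps matrix_vector_mul_assoc[symmetric] Suc.IH
    by (simp add: mat_vec_simps vector_add_ldistrib)
  then show ?case
    unfolding eq by (simp only: vector_smult_assoc power_Suc2)
qed

lemma jform_back_sol_Suc:
  fixes x z k
  defines "g \<equiv> back_sol \<rho> k z *v x"
  shows "jform (back_sol \<rho> (Suc k) z *v x) =
    (1 + (cmod z)\<^sup>2 / 4) * jform g + Im z * ((j_mat *v g) \<bullet> (C_mat (\<rho> k) *v (j_mat *v g)))"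
proof -
  have "back_sol \<rho> (Suc k) z *v x = g + (- (\<i> * z / 2)) *s (C_mat (\<rho> k) *v (j_mat *v g))"
    by (simp add: g_def back_sol.simps(2) mat_vec_simps)
  then show ?thesis
    using jform_step[OF C_herm C_jC C_pos, where x = g and a = "- (\<i> * z / 2)"]
    by (simp add: norm_mult norm_divide power_divide)
qed

text \<open>
  In the direction of the frame the step subtracts a nonnegative multiple of the form of \<open>j C j\<close>.
  The strict sign is what makes the denominator of the linear fractional transformation invertible.
\<close>

lemma jform_trans_mat_neg:
  assumes "0 < Im z" "jform x < 0"
  shows "jform (trans_mat \<rho> n z *v x) < 0"
  using assms(2)
proof (induction n arbitrary: x)
  case 0
  then show ?case by (simp add: trans_mat_def mat_adj_mat)
next
  case (Suc n)
  let ?q = "(j_mat *v x) \<bullet> (C_mat (\<rho> n) *v (j_mat *v x))"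
  let ?y = "x + (\<i> * z / 2) *s (C_mat (\<rho> n) *v (j_mat *v x))"
  have "jform ?y = (1 + (cmod z)\<^sup>2 / 4) * jform x - Im z * ?q"
    using jform_step[OF C_herm C_jC C_pos, where x = x and a = "\<i> * z / 2"]
    by (simp add: norm_mult norm_divide power_divide)
  moreover have "(1 + (cmod z)\<^sup>2 / 4) * jform x < 0"
    using Suc.prems by (intro mult_pos_neg add_pos_nonneg) auto
  moreover have "0 \<le> Im z * ?q"
    using assms(1) jCj_nonneg[OF C_herm C_jC C_pos] by simp
  ultimately have "jform ?y < 0" by linarith
  then show ?case
    using Suc.IH by (simp add: trans_mat_Suc_vec)
qed

lemma jform_back_sol_growth:
  assumes "0 < Im z"
  shows "(1 + (cmod z)\<^sup>2 / 4) * jform (back_sol \<rho> k z *v x) \<le> jform (back_sol \<rho> (Suc k) z *v x)"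
    and "(1 + (cmod z)\<^sup>2 / 4 + Im z) * jform (back_sol \<rho> k z *v x) \<le> jform (back_sol \<rho> (Suc k) z *v x)"
  using assms mult_left_mono[OF jCj_ge_j[OF C_herm[of k] C_jC C_pos, where x="back_sol \<rho> k z *v x"], of "Im z"]
  by (auto simp: jform_back_sol_Suc jCj_nonneg[OF C_herm C_jC C_pos] algebra_simps)

lemma jform_back_sol_neg_earlier:
  assumes "0 < Im z" "jform (back_sol \<rho> m z *v x) \<le> 0" "k \<le> m"
  shows "jform (back_sol \<rho> k z *v x) \<le> 0"
  using assms(3,2)
proof (induction rule: dec_induct)
  case (step m)
  have "(1 + (cmod z)\<^sup>2 / 4) * jform (back_sol \<rho> m z *v x) \<le> 0"
    using jform_back_sol_growth(1)[OF assms(1), of m x] step.prems by linarith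
  moreover have "0 < 1 + (cmod z)\<^sup>2 / 4"
    by (simp add: add_pos_nonneg)
  ultimately show ?case
    using step.IH by (simp add: mult_le_0_iff)
qed

section \<open>Limit point uniqueness\<close>

text \<open>
  The form of the difference, normalised by \<open>c\<^sup>m\<close>, is bounded above: by the parallelogram law it equals
  a nonpositive number minus the normalised form of the sum, and the latter is nondecreasing in \<open>m\<close>.
  If the difference were nonzero, its form would be positive after one step, even when it starts
  neutral, and from then on it would grow at least geometrically with ratio \<open>1 + Im z / c\<close>.
\<close>

lemma limit_point_uniqueness:
  assumes z: "0 < Im z"
    and v: "\<And>m. jform (back_sol \<rho> m z *v v) \<le> 0" and w: "\<And>m. jform (back_sol \<rho> m z *v w) \<le> 0"
    and vw: "0 \<le> jform (v - w)"
  shows "v = w"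
proof (rule ccontr)
  assume "v \<noteq> w"
  define c where "c = 1 + (cmod z)\<^sup>2 / 4"
  have c: "0 < c" by (simp add: c_def add_pos_nonneg)
  define H where "H x m = jform (back_sol \<rho> m z *v x) / c ^ m" for x m
  define q where "q = 1 + Im z / c"
  have q: "1 < q" using z c by (simp add: q_def)
  have H_growth: "q * H x m \<le> H x (Suc m)" for x m
  proof -
    have "q * H x m = (c + Im z) * jform (back_sol \<rho> m z *v x) / c ^ Suc m"
      using c by (simp add: H_def q_def field_simps)
    also have "\<dots> \<le> H x (Suc m)"
      unfolding H_def using jform_back_sol_growth(2)[OF z, of m x] c
      by (intro divide_right_mono) (auto simp: c_def)
    finally show ?thesis .
  qed
  have H_mono: "H x m \<le> H x (Suc m)" for x m
  proof -
    have "H x m = c * jform (back_sol \<rho> m z *v x) / c ^ Suc m"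
      using c by (simp add: H_def)
    also have "\<dots> \<le> H x (Suc m)"
      unfolding H_def using jform_back_sol_growth(1)[OF z, of m x] c
      by (intro divide_right_mono) (auto simp: c_def)
    finally show ?thesis .
  qed
  have H_le: "H (v - w) m \<le> - H (v + w) 0" for m
  proof -
    have "H (v + w) m + H (v - w) m = 2 * H v m + 2 * H w m"
      using jform_parallelogram[of "back_sol \<rho> m z *v v" "back_sol \<rho> m z *v w"]
      by (simp add: H_def mat_vec_simps flip: add_divide_distrib)
    moreover have "H v m \<le> 0" "H w m \<le> 0"
      using v w c by (simp_all add: H_def divide_nonpos_pos)
    moreover have "H (v + w) 0 \<le> H (v + w) m"
      using lift_Suc_mono_le[of "H (v + w)", OF H_mono] by simp
    ultimately show ?thesis by linarith
  qed
  have H1: "0 < H (v - w) 1"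
  proof -
    have "0 < Im z * ((j_mat *v (v - w)) \<bullet> (C_mat (\<rho> 0) *v (j_mat *v (v - w))))"
      using z jCj_pos[OF C_herm C_jC C_pos, of "v - w"] \<open>v \<noteq> w\<close> by simp
    moreover have "0 \<le> c * jform (v - w)"
      using c vw by simp
    ultimately have "0 < jform (back_sol \<rho> (Suc 0) z *v (v - w))"
      unfolding jform_back_sol_Suc by (simp add: c_def)
    then show ?thesis using c by (simp add: H_def)
  qed
  have H_ge: "q ^ m * H (v - w) 1 \<le> H (v - w) (Suc m)" for m
  proof (induction m)
    case (Suc m)
    have "q ^ Suc m * H (v - w) 1 \<le> q * H (v - w) (Suc m)"
      using Suc q by simp
    also have "\<dots> \<le> H (v - w) (Suc (Suc m))" by (rule H_growth)
    finally show ?case .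
  qed simp
  have q_le: "q ^ m \<le> - H (v + w) 0 / H (v - w) 1" for m
    using order_trans[OF H_ge[of m] H_le[of "Suc m"]] H1 by (simp only: pos_le_divide_eq)
  obtain m where "- H (v + w) 0 / H (v - w) 1 < q ^ m"
    using real_arch_pow[OF q] by blast
  then show False using q_le[of m] by linarith
qed

end

section \<open>Linear fractional transformations of Herglotz functions\<close>

text \<open>
  As \<open>b\<close> varies, these vectors run through the subspace that represents the matrix \<open>M\<close>, in the
  coordinates in which the form is given by \<open>j\<close>.
\<close>

definition graph_vec :: "complex ^ 'p ^ 'p \<Rightarrow> complex ^ 'p \<Rightarrow> complex ^ ('p::finite + 'p)" where
  "graph_vec M b = mat_adj T_mat *v vec_join ((mat (- \<i>) ** M) *v b) b"

lemma mat_vec_join: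
  "F *v vec_join a b = vec_join (block11 F *v a + block12 F *v b) (block21 F *v a + block22 F *v b)"
  for F :: "complex ^ ('p::finite + 'p) ^ ('p + 'p)"
  by (metis block_collapse block_vec_join)

text \<open>
  A linear fractional transformation is the action of \<open>F\<close> on the subspace spanned by the columns of
  \<open>[R; Q]\<close>; the matrix inverse only renormalises the spanning vectors.
\<close>

lemma linear_fractional_vec:
  fixes F :: "complex ^ ('p::finite + 'p) ^ ('p + 'p)"
  assumes inv: "invertible (block21 F ** R + block22 F ** Q)"
    and M: "M = mat \<i> ** (block11 F ** R + block12 F ** Q)
               ** matrix_inv (block21 F ** R + block22 F ** Q)"
    and c: "c = matrix_inv (block21 F ** R + block22 F ** Q) *v b"
  shows "F *v (block_col R Q *v c) = vec_join ((mat (- \<i>) ** M) *v b) b"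
proof -
  have "(block21 F ** R + block22 F ** Q) *v c = b"
    by (simp add: c matrix_vector_mul_assoc matrix_inv_both_sides[OF inv])
  moreover have "(mat (- \<i>) ** M) *v b = (block11 F ** R + block12 F ** Q) *v c"
    by (simp add: M c mat_vec_simps)
  ultimately show ?thesis
    by (simp add: block_col_vec mat_vec_join mat_vec_simps)
qed

lemma open_upper_half_plane: "open upper_half_plane"
  unfolding upper_half_plane_def by (rule open_halfspace_Im_gt)

text \<open>
  Where the representation by a pair \<open>{R, Q}\<close> is valid, the vector is a scalar multiple of
  \<open>T\<^sup>* [R; Q] c\<close>, whose form is nonpositive by property-\<open>J\<close>.  The exceptional points do not
  accumulate in the half-plane and the form is continuous in \<open>z\<close>, so the inequality persists there.
\<close>

lemma N_family_jform_nonpos: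
  fixes \<rho> :: "nat \<Rightarrow> complex ^ 'p ^ ('p::finite)"
  assumes contractive: "\<And>k. onorm ((*v) (\<rho> k)) < 1"
    and \<phi>: "\<phi> \<in> N_family (frame \<rho> m)" and z: "z \<in> upper_half_plane"
  shows "jform (back_sol \<rho> m z *v graph_vec (\<phi> z) b) \<le> 0"
proof -
  let ?f = "\<lambda>z. jform (back_sol \<rho> m z *v graph_vec (\<phi> z) b)"
  obtain R Q where RQ: "nonsingular_J_pair R Q"
    and ev: "\<forall>\<^sub>F z in cosparse upper_half_plane.
          invertible (block21 (frame \<rho> m z) ** R z + block22 (frame \<rho> m z) ** Q z) \<and>
          \<phi> z = mat \<i> ** (block11 (frame \<rho> m z) ** R z + block12 (frame \<rho> m z) ** Q z)
                   ** matrix_inv (block21 (frame \<rho> m z) ** R z + block22 (frame \<rho> m z) ** Q z)"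
    and hol: "\<forall>a b. (\<lambda>z. \<phi> z $ a $ b) holomorphic_on upper_half_plane"
    using \<phi> unfolding N_family_def by blast
  from RQ have "\<forall>\<^sub>F z in cosparse upper_half_plane.
      pos_semidef (mat_adj (block_col (R z) (Q z)) ** J_mat ** block_col (R z) (Q z))"
    unfolding nonsingular_J_pair_def by (auto elim: eventually_mono)
  with ev have "\<forall>\<^sub>F z in cosparse upper_half_plane. ?f z \<le> 0"
  proof eventually_elim
    case (elim z)
    define c where "c = matrix_inv (block21 (frame \<rho> m z) ** R z + block22 (frame \<rho> m z) ** Q z) *v b"
    define y where "y = block_col (R z) (Q z) *v c"
    define s where "s = inverse ((1 - \<i> / 2 * z) ^ m) * (1 + z\<^sup>2 / 4) ^ m"
    have "graph_vec (\<phi> z) b = mat_adj T_mat *v (frame \<rho> m z *v y)"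
      unfolding graph_vec_def y_def using linear_fractional_vec[OF _ _ c_def] elim by metis
    then have "back_sol \<rho> m z *v graph_vec (\<phi> z) b = s *s (mat_adj T_mat *v y)"
      by (simp add: frame_vec mat_vec_smult back_sol_trans_mat[where \<rho> = \<rho>, OF contractive] s_def)
    then have "?f z = - (cmod s)\<^sup>2 * (y \<bullet> (J_mat *v y))"
      by (simp add: jform_smult jform_T_adj)
    moreover have "0 \<le> y \<bullet> (J_mat *v y)"
      using elim unfolding pos_semidef_def
      by (simp add: y_def inner_mat_adj matrix_vector_mul_assoc matrix_mul_assoc)
    ultimately show ?case by simp
  qed
  then have "\<forall>\<^sub>F z in at z. ?f z \<le> 0"
    using z by (rule eventually_cosparse_imp_eventually_at)
  moreover have "continuous_on upper_half_plane ?f"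
  proof -
    have "continuous_on upper_half_plane \<phi>"
      using hol by (intro continuous_on_matrixI holomorphic_on_imp_continuous_on) auto
    then have "continuous_on upper_half_plane (\<lambda>z. graph_vec (\<phi> z) b)"
      unfolding graph_vec_def mat_vec_simps
      by (intro continuous_intros continuous_on_vec_join continuous_on_smult continuous_on_mat_vec)
    then show ?thesis
      unfolding jform_def
      by (intro continuous_intros continuous_on_back_sol continuous_on_mat_vec)
  qed
  then have "?f \<midarrow>z\<rightarrow> ?f z"
    using z open_upper_half_plane by (simp add: continuous_on_eq_continuous_at isCont_def)
  ultimately show ?thesis
    by (intro tendsto_upperbound[where f = ?f and F = "at z"]) simp_all
qed

lemma graph_vec_eq_0: "graph_vec M b = 0 \<Longrightarrow> b = 0"
proof -
  assume "graph_vec M b = 0"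
  from arg_cong[OF this, of "(*v) T_mat"] have "vec_join ((mat (- \<i>) ** M) *v b) b = vec_join 0 0"
    by (simp only: graph_vec_def T_adj_T vec_join_0 matrix_vector_mult_0_right)
  then show "b = 0"
    by (simp only: vec_join_eq_iff)
qed

section \<open>The Weyl function of a shifted sequence\<close>

theorem theorem3p4:
  fixes \<rho> :: "nat \<Rightarrow> complex ^ 'p ^ ('p::finite)"
    and n :: nat
    and \<phi> \<phi>' :: "complex \<Rightarrow> complex ^ 'p ^ 'p"
  assumes contractive: "\<And>k. onorm ((*v) (\<rho> k)) < 1"
    and "is_weyl_function \<rho> \<phi>"
    and "is_weyl_function (\<lambda>k. \<rho> (k + n)) \<phi>'"
    and "z \<in> upper_half_plane"
  shows "invertible (block21 (frame \<rho> n z) ** (mat (- \<i>) ** \<phi>' z) + block22 (frame \<rho> n z)) \<and>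
         \<phi> z = mat \<i> ** (block11 (frame \<rho> n z) ** (mat (- \<i>) ** \<phi>' z) + block12 (frame \<rho> n z))
                  ** matrix_inv (block21 (frame \<rho> n z) ** (mat (- \<i>) ** \<phi>' z) + block22 (frame \<rho> n z))"
proof -
  let ?\<rho>' = "\<lambda>k. \<rho> (k + n)"
  let ?F = "frame \<rho> n z" and ?M = "mat (- \<i>) ** \<phi>' z"
  let ?R = "block11 ?F ** ?M + block12 ?F" and ?Q = "block21 ?F ** ?M + block22 ?F"
  define s where "s = inverse ((1 - \<i> / 2 * z) ^ n)"
  have z: "0 < Im z" using assms(4) by (simp add: upper_half_plane_def)
  have contractive': "\<And>k. onorm ((*v) (?\<rho>' k)) < 1" by (rule contractive)
  have \<phi>: "jform (back_sol \<rho> m z *v graph_vec (\<phi> z) b) \<le> 0" for m b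
  proof -
    have "\<phi> \<in> N_family (frame \<rho> (Suc m))"
      using assms(2) by (simp add: is_weyl_function_def)
    then have "jform (back_sol \<rho> (Suc m) z *v graph_vec (\<phi> z) b) \<le> 0"
      by (rule N_family_jform_nonpos[where \<rho> = \<rho>, OF contractive _ assms(4)])
    then show ?thesis
      by (rule jform_back_sol_neg_earlier[where \<rho> = \<rho>, OF contractive z]) simp
  qed
  have \<phi>': "jform (back_sol ?\<rho>' m z *v graph_vec (\<phi>' z) b) \<le> 0" for m b
  proof -
    have "\<phi>' \<in> N_family (frame ?\<rho>' (Suc m))"
      using assms(3) by (simp add: is_weyl_function_def)
    then have "jform (back_sol ?\<rho>' (Suc m) z *v graph_vec (\<phi>' z) b) \<le> 0"
      by (rule N_family_jform_nonpos[where \<rho> = ?\<rho>', OF contractive' _ assms(4)])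
    then show ?thesis
      by (rule jform_back_sol_neg_earlier[where \<rho> = ?\<rho>', OF contractive' z]) simp
  qed
  \<comment> \<open>A Herglotz function in the family of the first shifted frame has strictly \<open>j\<close>-negative vectors,
    since the first step of the system increases the form strictly.\<close>
  have neg: "jform (graph_vec (\<phi>' z) b) < 0" if "b \<noteq> 0" for b
  proof -
    let ?x = "graph_vec (\<phi>' z) b"
    have "0 < Im z * ((j_mat *v ?x) \<bullet> (C_mat (?\<rho>' 0) *v (j_mat *v ?x)))"
      using z jCj_pos[OF C_mat_hermitian_j_unitary_pos_def[where \<rho> = "?\<rho>' 0", OF contractive'], of ?x] that
      by (intro mult_pos_pos) (auto dest: graph_vec_eq_0)
    moreover have "jform (back_sol ?\<rho>' (Suc 0) z *v ?x) \<le> 0" by (rule \<phi>')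
    ultimately have "(1 + (cmod z)\<^sup>2 / 4) * jform ?x < 0"
      unfolding jform_back_sol_Suc[where \<rho> = ?\<rho>', OF contractive'] by simp
    moreover have "0 < 1 + (cmod z)\<^sup>2 / 4" by (simp add: add_pos_nonneg)
    ultimately show ?thesis by (simp add: mult_less_0_iff)
  qed
  have F: "mat_adj T_mat *v vec_join (?R *v c) (?Q *v c) = s *s (trans_mat \<rho> n z *v graph_vec (\<phi>' z) c)" for c
    unfolding s_def graph_vec_def frame_vec[symmetric]
    by (simp add: mat_vec_join matrix_vector_mult_add_rdistrib matrix_vector_mul_assoc)
  have inv: "invertible ?Q"
  proof (rule invertible_if_kernel_trivial)
    fix c assume Qc: "?Q *v c = 0"
    show "c = 0"
    proof (rule ccontr)
      assume "c \<noteq> 0"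
      then have "jform (trans_mat \<rho> n z *v graph_vec (\<phi>' z) c) < 0"
        by (intro jform_trans_mat_neg[where \<rho> = \<rho>, OF contractive z] neg)
      moreover have "1 - \<i> / 2 * z \<noteq> 0"
        using z by (auto simp: complex_eq_iff)
      then have "0 < (cmod s)\<^sup>2" by (simp add: s_def)
      ultimately have "jform (mat_adj T_mat *v vec_join (?R *v c) (?Q *v c)) < 0"
        unfolding F jform_smult by (rule mult_pos_neg[rotated])
      \<comment> \<open>A vector in the kernel of the denominator would be mapped to a \<open>J\<close>-neutral vector \<open>[a; 0]\<close>.\<close>
      then show False
        by (simp add: Qc jform_T_adj J_vec inner_vec_join)
    qed
  qed
  have "\<phi> z = mat \<i> ** ?R ** matrix_inv ?Q"
  proof (rule matrix_eqI_vec)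
    fix b
    define c where "c = matrix_inv ?Q *v b"
    have Qc: "?Q *v c = b"
      by (simp add: c_def matrix_vector_mul_assoc matrix_inv_both_sides[OF inv])
    let ?v = "graph_vec (\<phi> z) b" and ?w = "mat_adj T_mat *v vec_join (?R *v c) b"
    have w: "?w = s *s (trans_mat \<rho> n z *v graph_vec (\<phi>' z) c)"
      using F[of c] by (simp only: Qc)
    \<comment> \<open>\<open>G\<^sub>n\<close> undoes the frame, and the remaining factor belongs to the shifted sequence.\<close>
    have "jform (back_sol \<rho> (n + m) z *v ?w) \<le> 0" for m
    proof -
      have "back_sol \<rho> (n + m) z *v ?w
          = (s * (1 + z\<^sup>2 / 4) ^ n) *s (back_sol ?\<rho>' m z *v graph_vec (\<phi>' z) c)"
        unfolding w by (simp add: back_sol_add mat_vec_simps back_sol_trans_mat[where \<rho> = \<rho>, OF contractive])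
      then show ?thesis
        using \<phi>'[of m c] by (simp add: jform_smult mult_le_0_iff)
    qed
    \<comment> \<open>The indices below \<open>n\<close> are covered because the sign is inherited by earlier steps.\<close>
    then have "jform (back_sol \<rho> m z *v ?w) \<le> 0" for m
      by (rule jform_back_sol_neg_earlier[where \<rho> = \<rho>, OF contractive z, OF _ le_add2])
    moreover have "jform (?v - ?w) = 0"
    proof -
      have "?v - ?w = mat_adj T_mat *v vec_join ((mat (- \<i>) ** \<phi> z) *v b - ?R *v c) 0"
        by (simp add: graph_vec_def vec_join_diff flip: matrix_vector_mult_diff_distrib)
      then show ?thesis
        by (simp add: jform_T_adj J_vec inner_vec_join)
    qed
    ultimately have "?v = ?w"
      by (intro limit_point_uniqueness[where \<rho> = \<rho>, OF contractive z \<phi>]) simp_all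
    then have "vec_join ((mat (- \<i>) ** \<phi> z) *v b) b = vec_join (?R *v c) b"
      unfolding graph_vec_def by (metis T_adj_T)
    then have "(- \<i>) *s (\<phi> z *v b) = ?R *v c"
      by (simp only: vec_join_eq_iff) (simp add: mat_vec_simps)
    then have "\<i> *s ((- \<i>) *s (\<phi> z *v b)) = \<i> *s (?R *v c)"
      by (rule arg_cong)
    then show "\<phi> z *v b = (mat \<i> ** ?R ** matrix_inv ?Q) *v b"
      by (simp add: c_def matrix_vector_mul_assoc[symmetric] mat_vec_mult)
  qed
  with inv show ?thesis by blast
qed

end
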